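(* Let $(\phi_n)_{n\ge0}$ be a sequence of non-negative functions in $\mathcal{B}$ with $\sup_n\|\phi_n\|<\infty$ and $E_n\to\infty$, where $E_n=\sum_{j=0}^{n-1}\int_X\phi_j\,d\mu$. Then $$\lim_{n\to\infty}\frac{1}{E_n}\sum_{j=0}^{n-1}\phi_j(T_{\omega_j}\circ\cdots\circ T_{\omega_1}x)=1$$ for $\tilde{\mathbb{P}}\otimes\mu$-a.e. $(\underline\omega,x)\in\tilde\Omega\times X$ (the $j=0$ term being $\phi_0(x)$).
   Context: Random system. $(\Omega,\mathcal{T},\mathbb{P})$ and $(X,\mathcal{A},m)$ are probability spaces; to each $\omega\in\Omega$ is associated a map $T_\omega:X\to X$, with $(\omega,x)\mapsto T_\omega(x)$ measurable and each $T_\omega$ non-singular with respect to $m$ (i.e. $m(A)=0$ implies $m(T_\omega^{-1}A)=0$). Set $\tilde\Omega=\Omega^{\mathbb{N}}$, with elements $\underline\omega=(\omega_1,\omega_2,\ldots)$, and $\tilde{\mathbb{P}}=\mathbb{P}^{\otimes\mathbb{N}}$. The transfer operator $P_\omega$ of $T_\omega$ acts on $L^1(m)$ and is characterized by $\int_X P_\omega f\, g\,dm=\int_X f\,(g\circ T_\omega)\,dm$ for $f\in L^1(m)$, $g\in L^\infty(m)$. The annealed transfer operator with respect to $m$ is $P=\int_\Omega P_\omega\,d\mathbb{P}(\omega)$ and the annealed Koopman operator is $Ug(x)=\int_\Omega g(T_\omega x)\,d\mathbb{P}(\omega)$. A probability measure $\mu$ on $X$ is stationary if $\mu(A)=\int_\Omega\mu(T_\omega^{-1}A)\,d\mathbb{P}(\omega)$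 for all $A\in\mathcal{A}$. Standing assumptions. There is a Banach space $(\mathcal{B},\|\cdot\|)$ of complex-valued functions such that: (1) $\mathcal{B}$ is compactly embedded in $L^1(m)$; (2) constant functions lie in $\mathcal{B}$; (3) $|f|,\bar f\in\mathcal{B}$ for all $f\in\mathcal{B}$ (complex Banach lattice); (4) $P(\mathcal{B})\subset\mathcal{B}$ and $P$ acts continuously on $\mathcal{B}$; (5) there are $N\ge1$, $\rho<1$, $K\ge0$ with $\|P^Nf\|\le\rho\|f\|+K\|f\|_{L^1(m)}$ for all $f\in\mathcal{B}$; (6) $1$ is a simple isolated eigenvalue of $P$ on $\mathcal{B}$ and there is no other eigenvalue on the unit circle. Then $\mu$ denotes the unique stationary probability measure absolutely continuous with respect to $m$; its density lies in $\mathcal{B}$. Moreover there is decay of correlations for $\mathcal{B}$ against $L^1(\mu)$: there are $C>0$ and $\lambda<1$ such that for all $n\ge0$, $f\in\mathcal{B}$, $g\in L^1(\mu)$, $$\left|\int_X f\,U^ng\,d\mu-\int_X f\,d\mu\int_X g\,d\mu\right|\le C\lambda^n\|f\|\,\|g\|_{L^1(\mu)}.$$ *)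

theory Defs
  imports "HOL-Probability.Probability"
begin

text \<open>
  Elements of \<open>L\<^sup>1(m)\<close> and \<open>L\<^sup>\<infinity>(m)\<close> are handled through representatives: functions that are
  never quotiented, with equality read almost everywhere.
\<close>

definition Linf :: "'x measure \<Rightarrow> ('x \<Rightarrow> complex) set" where
  "Linf m = {g \<in> borel_measurable m. \<exists>C. AE x in m. cmod (g x) \<le> C}"

text \<open>
  For \<open>f\<close> integrable and \<open>S\<close> non-singular the representative chosen in the next definition exists by
  the Radon-Nikodym theorem, and it is unique up to null sets.
\<close>

definition transfer_op ::
    "'x measure \<Rightarrow> ('x \<Rightarrow> 'x) \<Rightarrow> ('x \<Rightarrow> complex) \<Rightarrow> 'x \<Rightarrow> complex" where
  "transfer_op m S f = (SOME h. integrable m h \<and>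
     (\<forall>g\<in>Linf m. (\<integral>x. h x * g x \<partial>m) = (\<integral>x. f x * g (S x) \<partial>m)))"

text \<open>
  The operator \<open>\<integral> P\<^sub>\<omega> dPr(\<omega>)\<close> is the weak integral with respect to the duality between
  \<open>L\<^sup>1(m)\<close> and \<open>L\<^sup>\<infinity>(m)\<close>, so no choice of versions of \<open>P\<^sub>\<omega> f\<close> jointly measurable in
  \<open>(\<omega>, x)\<close> is involved.  The outer integrand is
  \<open>\<omega> \<mapsto> \<integral> f \<cdot> (g \<circ> T\<^sub>\<omega>) dm\<close>, which is measurable and bounded by
  \<open>\<parallel>f\<parallel>\<^sub>1 \<parallel>g\<parallel>\<^sub>\<infinity>\<close>; existence and almost everywhere uniqueness are as before.
\<close>

definition annealed_transfer_op ::
    "'w measure \<Rightarrow> 'x measure \<Rightarrow> ('w \<Rightarrow> 'x \<Rightarrow> 'x) \<Rightarrow> ('x \<Rightarrow> complex) \<Rightarrow> 'x \<Rightarrow> complex" where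
  "annealed_transfer_op Pr m T f = (SOME h. integrable m h \<and>
     (\<forall>g\<in>Linf m. (\<integral>x. h x * g x \<partial>m) =
        (\<integral>\<omega>. (\<integral>x. transfer_op m (T \<omega>) f x * g x \<partial>m) \<partial>Pr)))"

definition koopman ::
    "'w measure \<Rightarrow> ('w \<Rightarrow> 'x \<Rightarrow> 'x) \<Rightarrow> ('x \<Rightarrow> complex) \<Rightarrow> 'x \<Rightarrow> complex" where
  "koopman Pr T g = (\<lambda>x. \<integral>\<omega>. g (T \<omega> x) \<partial>Pr)"

definition stationary :: "'w measure \<Rightarrow> ('w \<Rightarrow> 'x \<Rightarrow> 'x) \<Rightarrow> 'x measure \<Rightarrow> bool" where
  "stationary Pr T \<mu> \<longleftrightarrow>
     (\<forall>A\<in>sets \<mu>. emeasure \<mu> A = (\<integral>\<^sup>+\<omega>. emeasure \<mu> (T \<omega> -` A \<inter> space \<mu>) \<partial>Pr))"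

definition ac_stationary ::
    "'w measure \<Rightarrow> 'x measure \<Rightarrow> ('w \<Rightarrow> 'x \<Rightarrow> 'x) \<Rightarrow> 'x measure \<Rightarrow> bool" where
  "ac_stationary Pr m T \<mu> \<longleftrightarrow>
     prob_space \<mu> \<and> sets \<mu> = sets m \<and> absolutely_continuous m \<mu> \<and> stationary Pr T \<mu>"

text \<open>
  A complex Banach space contained in \<open>L\<^sup>1(m)\<close> is given by the set \<open>B\<close> of all representatives of
  its elements and by the norm \<open>nB\<close>, viewed as a function of representatives; hence the
  conditions \<open>saturated\<close> and \<open>norm_zero\<close>.
\<close>

locale banach_function_space =
  fixes m :: "'x measure" and B :: "('x \<Rightarrow> complex) set" and nB :: "('x \<Rightarrow> complex) \<Rightarrow> real"
  assumes subset_L1: "f \<in> B \<Longrightarrow> integrable m f"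
    and saturated: "\<lbrakk>f \<in> B; g \<in> borel_measurable m; AE x in m. f x = g x\<rbrakk> \<Longrightarrow> g \<in> B \<and> nB g = nB f"
    and zero_mem: "(\<lambda>x. 0) \<in> B"
    and add_mem: "\<lbrakk>f \<in> B; g \<in> B\<rbrakk> \<Longrightarrow> (\<lambda>x. f x + g x) \<in> B"
    and scale_mem: "f \<in> B \<Longrightarrow> (\<lambda>x. c * f x) \<in> B"
    and norm_nonneg: "f \<in> B \<Longrightarrow> 0 \<le> nB f"
    and norm_zero: "f \<in> B \<Longrightarrow> nB f = 0 \<longleftrightarrow> (AE x in m. f x = 0)"
    and norm_triangle: "\<lbrakk>f \<in> B; g \<in> B\<rbrakk> \<Longrightarrow> nB (\<lambda>x. f x + g x) \<le> nB f + nB g"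
    and norm_scale: "f \<in> B \<Longrightarrow> nB (\<lambda>x. c * f x) = cmod c * nB f"
    and complete:
      "\<lbrakk>\<And>n. F n \<in> B; \<And>\<epsilon>. 0 < \<epsilon> \<Longrightarrow> \<exists>N. \<forall>i\<ge>N. \<forall>j\<ge>N. nB (\<lambda>x. F i x - F j x) < \<epsilon>\<rbrakk>
       \<Longrightarrow> \<exists>f\<in>B. (\<lambda>n. nB (\<lambda>x. F n x - f x)) \<longlonglongrightarrow> 0"

text \<open>Sequential form: norm-bounded subsets of \<open>B\<close> are relatively compact in \<open>L\<^sup>1(m)\<close>.\<close>

definition compactly_embedded_L1 ::
    "'x measure \<Rightarrow> ('x \<Rightarrow> complex) set \<Rightarrow> (('x \<Rightarrow> complex) \<Rightarrow> real) \<Rightarrow> bool" where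
  "compactly_embedded_L1 m B nB \<longleftrightarrow>
     (\<forall>F :: nat \<Rightarrow> 'x \<Rightarrow> complex. (\<forall>n. F n \<in> B) \<and> bdd_above (range (\<lambda>n. nB (F n))) \<longrightarrow>
        (\<exists>r h. strict_mono r \<and> integrable m h \<and>
               (\<lambda>n. \<integral>x. cmod (F (r n) x - h x) \<partial>m) \<longlonglongrightarrow> 0))"

definition eigenvector ::
    "'x measure \<Rightarrow> ('x \<Rightarrow> complex) set \<Rightarrow> (('x \<Rightarrow> complex) \<Rightarrow> 'x \<Rightarrow> complex) \<Rightarrow> complex
     \<Rightarrow> ('x \<Rightarrow> complex) \<Rightarrow> bool" where
  "eigenvector m B L z f \<longleftrightarrow>
     f \<in> B \<and> \<not> (AE x in m. f x = 0) \<and> (AE x in m. L f x = z * f x)"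

definition eigenvalue ::
    "'x measure \<Rightarrow> ('x \<Rightarrow> complex) set \<Rightarrow> (('x \<Rightarrow> complex) \<Rightarrow> 'x \<Rightarrow> complex) \<Rightarrow> complex \<Rightarrow> bool" where
  "eigenvalue m B L z \<longleftrightarrow> (\<exists>f. eigenvector m B L z f)"

text \<open>Simplicity means algebraic multiplicity one.\<close>

definition simple_eigenvalue ::
    "'x measure \<Rightarrow> ('x \<Rightarrow> complex) set \<Rightarrow> (('x \<Rightarrow> complex) \<Rightarrow> 'x \<Rightarrow> complex) \<Rightarrow> complex \<Rightarrow> bool" where
  "simple_eigenvalue m B L z \<longleftrightarrow>
     (\<exists>e. eigenvector m B L z e \<and>
        (\<forall>f\<in>B. \<forall>k. (AE x in m. ((\<lambda>u y. L u y - z * u y) ^^ k) f x = 0) \<longrightarrow>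
           (\<exists>c. AE x in m. f x = c * e x)))"

text \<open>Bounded invertibility of \<open>z - L\<close>; the lower bound includes injectivity.\<close>

definition in_resolvent_set ::
    "'x measure \<Rightarrow> ('x \<Rightarrow> complex) set \<Rightarrow> (('x \<Rightarrow> complex) \<Rightarrow> real)
     \<Rightarrow> (('x \<Rightarrow> complex) \<Rightarrow> 'x \<Rightarrow> complex) \<Rightarrow> complex \<Rightarrow> bool" where
  "in_resolvent_set m B nB L z \<longleftrightarrow>
     (\<forall>g\<in>B. \<exists>f\<in>B. AE x in m. z * f x - L f x = g x) \<and>
     (\<exists>C. \<forall>f\<in>B. nB f \<le> C * nB (\<lambda>x. z * f x - L f x))"

definition isolated_in_spectrum ::
    "'x measure \<Rightarrow> ('x \<Rightarrow> complex) set \<Rightarrow> (('x \<Rightarrow> complex) \<Rightarrow> real)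
     \<Rightarrow> (('x \<Rightarrow> complex) \<Rightarrow> 'x \<Rightarrow> complex) \<Rightarrow> complex \<Rightarrow> bool" where
  "isolated_in_spectrum m B nB L z \<longleftrightarrow>
     \<not> in_resolvent_set m B nB L z \<and>
     (\<exists>\<epsilon>>0. \<forall>w. 0 < cmod (w - z) \<and> cmod (w - z) < \<epsilon> \<longrightarrow> in_resolvent_set m B nB L w)"

locale random_system = Pr: prob_space Pr + m: prob_space m
  for Pr :: "'w measure" and m :: "'x measure" +
  fixes T :: "'w \<Rightarrow> 'x \<Rightarrow> 'x"
  assumes T_measurable: "(\<lambda>(\<omega>, x). T \<omega> x) \<in> measurable (Pr \<Otimes>\<^sub>M m) m"
    and nonsingular:
      "\<lbrakk>\<omega> \<in> space Pr; A \<in> null_sets m\<rbrakk> \<Longrightarrow> T \<omega> -` A \<inter> space m \<in> null_sets m"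

locale random_system_on_banach_space =
  random_system Pr m T + banach_function_space m B nB
  for Pr :: "'w measure" and m :: "'x measure" and T :: "'w \<Rightarrow> 'x \<Rightarrow> 'x"
    and B :: "('x \<Rightarrow> complex) set" and nB :: "('x \<Rightarrow> complex) \<Rightarrow> real" +
  assumes compact_embedding: "compactly_embedded_L1 m B nB"
    and const_mem: "(\<lambda>x. c) \<in> B"
    and cmod_mem: "f \<in> B \<Longrightarrow> (\<lambda>x. complex_of_real (cmod (f x))) \<in> B"
    and cnj_mem: "f \<in> B \<Longrightarrow> (\<lambda>x. cnj (f x)) \<in> B"
    and transfer_mem: "f \<in> B \<Longrightarrow> annealed_transfer_op Pr m T f \<in> B"
    and transfer_bounded: "\<exists>C. \<forall>f\<in>B. nB (annealed_transfer_op Pr m T f) \<le> C * nB f"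
    and lasota_yorke:
      "\<exists>N\<ge>1. \<exists>\<rho><1. \<exists>K\<ge>0. \<forall>f\<in>B.
         nB ((annealed_transfer_op Pr m T ^^ N) f) \<le> \<rho> * nB f + K * (\<integral>x. cmod (f x) \<partial>m)"
    and one_simple: "simple_eigenvalue m B (annealed_transfer_op Pr m T) 1"
    and one_isolated: "isolated_in_spectrum m B nB (annealed_transfer_op Pr m T) 1"
    and no_other_unimodular:
      "\<lbrakk>eigenvalue m B (annealed_transfer_op Pr m T) z; cmod z = 1\<rbrakk> \<Longrightarrow> z = 1"

text \<open>
  The bound on correlations is a hypothesis of its own: it does not follow from the assumptions
  of \<open>random_system_on_banach_space\<close>, since for \<open>n = 0\<close> it forces \<open>B \<subseteq> L\<^sup>\<infinity>(\<mu>)\<close>.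
\<close>

definition decay_of_correlations ::
    "'w measure \<Rightarrow> ('w \<Rightarrow> 'x \<Rightarrow> 'x) \<Rightarrow> ('x \<Rightarrow> complex) set \<Rightarrow> (('x \<Rightarrow> complex) \<Rightarrow> real)
     \<Rightarrow> 'x measure \<Rightarrow> bool" where
  "decay_of_correlations Pr T B nB \<mu> \<longleftrightarrow>
     (\<exists>C>0. \<exists>\<theta><1. \<forall>n. \<forall>f\<in>B. \<forall>g. integrable \<mu> g \<longrightarrow>
        integrable \<mu> (\<lambda>x. f x * (koopman Pr T ^^ n) g x) \<and>
        cmod ((\<integral>x. f x * (koopman Pr T ^^ n) g x \<partial>\<mu>) - (\<integral>x. f x \<partial>\<mu>) * (\<integral>x. g x \<partial>\<mu>))
          \<le> C * \<theta> ^ n * nB f * (\<integral>x. cmod (g x) \<partial>\<mu>))"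

locale decaying_random_system =
  random_system_on_banach_space Pr m T B nB
  for Pr :: "'w measure" and m :: "'x measure" and T :: "'w \<Rightarrow> 'x \<Rightarrow> 'x"
    and B :: "('x \<Rightarrow> complex) set" and nB :: "('x \<Rightarrow> complex) \<Rightarrow> real" +
  fixes \<mu> :: "'x measure"
  assumes mu_ac_stationary: "ac_stationary Pr m T \<mu>"
    and mu_unique: "ac_stationary Pr m T \<nu> \<Longrightarrow> \<nu> = \<mu>"
    and density_mem: "(\<lambda>x. complex_of_real (enn2real (RN_deriv m \<mu> x))) \<in> B"
    and decay: "decay_of_correlations Pr T B nB \<mu>"

text \<open>
  A sequence \<open>w\<close> lists \<open>(\<omega>\<^sub>1, \<omega>\<^sub>2, \<dots>)\<close> starting from index \<open>0\<close>, so \<open>w n\<close> is \<open>\<omega>\<^bsub>n+1\<^esub>\<close> and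
  \<open>random_orbit T w n x\<close> is \<open>(T\<^sub>\<omega>\<^sub>n \<circ> \<dots> \<circ> T\<^sub>\<omega>\<^sub>1) x\<close>.
\<close>

primrec random_orbit :: "('w \<Rightarrow> 'x \<Rightarrow> 'x) \<Rightarrow> (nat \<Rightarrow> 'w) \<Rightarrow> nat \<Rightarrow> 'x \<Rightarrow> 'x" where
  "random_orbit T w 0 x = x"
| "random_orbit T w (Suc n) x = T (w n) (random_orbit T w n x)"

end

theory Submission
  imports Defs
begin

text \<open>
  Write \<open>X\<^sub>j(w, x) = \<phi>\<^sub>j(T\<^sub>\<omega>\<^sub>j \<circ> \<dots> \<circ> T\<^sub>\<omega>\<^sub>1 x)\<close> and \<open>a\<^sub>j = \<integral> \<phi>\<^sub>j d\<mu>\<close>.  The argument is a second moment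
  method, driven by the fact that correlations decay for \<open>B\<close> against \<open>L\<^sup>1(\<mu>)\<close>.

  Since \<open>\<mu>\<close> is stationary, the skew product over the shift preserves the product measure
  (\<open>nn_integral_skew_product\<close>).  Hence \<open>X\<^sub>j\<close> has mean \<open>a\<^sub>j\<close>, and for \<open>i \<le> j\<close> the expectation of
  \<open>X\<^sub>i X\<^sub>j\<close> is \<open>\<integral> \<phi>\<^sub>i \<cdot> U\<^sup>j\<^sup>-\<^sup>i \<phi>\<^sub>j d\<mu>\<close> (\<open>integral_orbit_product\<close>).  Decay of correlations bounds the
  covariance by \<open>C \<theta>\<^sup>j\<^sup>-\<^sup>i \<parallel>\<phi>\<^sub>i\<parallel> a\<^sub>j\<close>, because the \<open>L\<^sup>1\<close> norm of the nonnegative function \<open>\<phi>\<^sub>j\<close> is its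
  mean.  The norms \<open>\<parallel>\<phi>\<^sub>i\<parallel>\<close> are bounded, so summing the geometric series gives
  \<open>Var(X\<^sub>0 + \<dots> + X\<^sub>n\<^sub>-\<^sub>1) \<le> c E\<^sub>n\<close> (\<open>variance_partial_sums_le\<close>).

  For nonnegative terms, a variance linear in the mean together with \<open>E\<^sub>n \<longlonglongrightarrow> \<infinity>\<close> yields the strong law
  (\<open>AE_partial_sums_over_means_tendsto_1\<close>): the ratio converges along times at which \<open>E\<close> is at
  least \<open>k\<^sup>2\<close>, where the normalised variances are summable, and the other times are reached by
  monotonicity.
\<close>

section \<open>A strong law from a variance bound\<close>

text \<open>
  The series \<open>\<Sum> Z\<^sub>k\<^sup>2\<close> has finite expectation, so it converges almost surely and its terms vanish
  in the limit.
\<close>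

lemma (in prob_space) AE_tendsto_zero_of_summable_second_moments:
  fixes Z :: "nat \<Rightarrow> 'a \<Rightarrow> real"
  assumes int: "\<And>k. integrable M (\<lambda>x. (Z k x)\<^sup>2)" and [measurable]: "\<And>k. Z k \<in> borel_measurable M"
    and bound: "\<And>k. (\<integral>x. (Z k x)\<^sup>2 \<partial>M) \<le> c k" and c: "summable c"
  shows "AE x in M. (\<lambda>k. Z k x) \<longlonglongrightarrow> 0"
proof -
  have c0: "0 \<le> c k" for k
    by (rule order_trans[OF _ bound]) simp
  have "(\<integral>\<^sup>+x. (\<Sum>k. ennreal ((Z k x)\<^sup>2)) \<partial>M) = (\<Sum>k. \<integral>\<^sup>+x. ennreal ((Z k x)\<^sup>2) \<partial>M)"
    by (rule nn_integral_suminf) simp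
  also have "\<dots> = (\<Sum>k. ennreal (\<integral>x. (Z k x)\<^sup>2 \<partial>M))"
    by (simp add: nn_integral_eq_integral[OF int])
  also have "\<dots> \<le> (\<Sum>k. ennreal (c k))"
    by (intro suminf_le ennreal_leI bound) auto
  also have "\<dots> = ennreal (\<Sum>k. c k)"
    by (rule suminf_ennreal2[OF c0 c])
  also have "\<dots> < \<infinity>" by simp
  finally have "AE x in M. (\<Sum>k. ennreal ((Z k x)\<^sup>2)) \<noteq> \<infinity>"
    by (intro nn_integral_PInf_AE) auto
  then show ?thesis
  proof (eventually_elim)
    case (elim x)
    have "summable (\<lambda>k. (Z k x)\<^sup>2)"
      by (rule summable_suminf_not_top) (use elim in auto)
    from summable_LIMSEQ_zero[OF this] show ?case by simp
  qed
qed

text \<open>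
  Cut the time axis into blocks \<open>k\<^sup>2 \<le> E n < (k + 1)\<^sup>2\<close>.  Inside a block \<open>s\<close> is monotone and
  \<open>E\<close> varies by at most the factor \<open>((k + 1) / k)\<^sup>2 \<longlonglongrightarrow> 1\<close>; hence \<open>s n / E n\<close> is squeezed between
  the values of this ratio at two times \<open>l k\<close> and \<open>u k\<close> that enclose the block.
\<close>

lemma ratio_tendsto_1_of_block_endpoints:
  fixes s E :: "nat \<Rightarrow> real" and l u :: "nat \<Rightarrow> nat"
  assumes s: "mono s" "\<And>n. 0 \<le> s n" and E: "filterlim E at_top sequentially"
    and l: "(\<lambda>k. s (l k) / E (l k)) \<longlonglongrightarrow> 1" and u: "(\<lambda>k. s (u k) / E (u k)) \<longlonglongrightarrow> 1"
    and block: "\<And>n k. \<lbrakk>(real k)\<^sup>2 \<le> E n; E n < (real k + 1)\<^sup>2\<rbrakk>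
      \<Longrightarrow> l k \<le> n \<and> n \<le> u k \<and> (real k)\<^sup>2 \<le> E (l k) \<and> E (u k) \<le> (real k + 1)\<^sup>2 \<and> (real k)\<^sup>2 \<le> E (u k)"
  shows "(\<lambda>n. s n / E n) \<longlonglongrightarrow> 1"
proof -
  define \<kappa> where "\<kappa> n = nat \<lfloor>sqrt (E n)\<rfloor>" for n
  have \<kappa>: "filterlim \<kappa> at_top sequentially"
    unfolding \<kappa>_def
    by (intro filterlim_compose[OF filterlim_nat_sequentially]
        filterlim_compose[OF filterlim_floor_sequentially]
        filterlim_compose[OF sqrt_at_top] E)
  have lo: "(\<lambda>k. s (l k) / E (l k) * (real k / (real k + 1))\<^sup>2) \<longlonglongrightarrow> 1"
  proof -
    have "(\<lambda>k. (real k / (real k + 1))) \<longlonglongrightarrow> 1" 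
      using LIMSEQ_n_over_Suc_n[where 'a=real] by (simp add: add.commute)
    from tendsto_mult[OF l tendsto_power[OF this, of 2]] show ?thesis by simp
  qed
  have up: "(\<lambda>k. s (u k) / E (u k) * ((real k + 1) / real k)\<^sup>2) \<longlonglongrightarrow> 1"
  proof -
    have "(\<lambda>k. ((real k + 1) / real k)) \<longlonglongrightarrow> 1" 
      using LIMSEQ_Suc_n_over_n[where 'a=real] by (simp add: add.commute)
    from tendsto_mult[OF u tendsto_power[OF this, of 2]] show ?thesis by simp
  qed
  have ev: "eventually (\<lambda>n. 1 \<le> E n) sequentially"
    using E by (simp add: filterlim_at_top)
  have sandwich: "s (l (\<kappa> n)) / E (l (\<kappa> n)) * (real (\<kappa> n) / (real (\<kappa> n) + 1))\<^sup>2 \<le> s n / E n \<and>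
      s n / E n \<le> s (u (\<kappa> n)) / E (u (\<kappa> n)) * ((real (\<kappa> n) + 1) / real (\<kappa> n))\<^sup>2"
    if n: "1 \<le> E n" for n
  proof -
    let ?k = "\<kappa> n"
    have k: "real ?k \<le> sqrt (E n)" "sqrt (E n) < real ?k + 1"
      using n unfolding \<kappa>_def by (simp_all) 
    have k1: "1 \<le> real ?k"
      using n unfolding \<kappa>_def by (simp add: le_nat_floor) 
    have E1: "(real ?k)\<^sup>2 \<le> E n"
      using power_mono[OF k(1), of 2] n by simp
    have E2: "E n < (real ?k + 1)\<^sup>2"
      using power_strict_mono[OF k(2), of 2] n by simp
    note b = block[OF E1 E2]
    have k2: "0 < (real ?k)\<^sup>2" using k1 by simp
    have El: "0 < E (l ?k)" and Eu: "0 < E (u ?k)" using b k2 by linarith+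
    have "s (l ?k) / E (l ?k) * (real ?k / (real ?k + 1))\<^sup>2
        = (s (l ?k) * ((real ?k)\<^sup>2 / E (l ?k))) / (real ?k + 1)\<^sup>2"
      by (simp add: power_divide)
    also have "\<dots> \<le> (s (l ?k) * 1) / (real ?k + 1)\<^sup>2"
      using b El s(2) by (intro divide_right_mono mult_left_mono) auto
    also have "\<dots> \<le> s n / E n"
      using E2 n s b by (intro frac_le) (auto simp: mono_def)
    finally have 1: "s (l ?k) / E (l ?k) * (real ?k / (real ?k + 1))\<^sup>2 \<le> s n / E n" .
    have "s n / E n \<le> s (u ?k) * 1 / (real ?k)\<^sup>2"
      using E1 k2 s b by (intro frac_le) (auto simp: mono_def)
    also have "\<dots> \<le> s (u ?k) * ((real ?k + 1)\<^sup>2 / E (u ?k)) / (real ?k)\<^sup>2"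
      using b Eu s(2) by (intro divide_right_mono mult_left_mono) auto
    also have "\<dots> = s (u ?k) / E (u ?k) * ((real ?k + 1) / real ?k)\<^sup>2"
      by (simp add: power_divide)
    finally show ?thesis using 1 by blast
  qed
  show ?thesis
  proof (rule tendsto_sandwich)
    show "\<forall>\<^sub>F n in sequentially. s (l (\<kappa> n)) / E (l (\<kappa> n)) * (real (\<kappa> n) / (real (\<kappa> n) + 1))\<^sup>2 \<le> s n / E n"
      using ev by eventually_elim (use sandwich in blast)
    show "\<forall>\<^sub>F n in sequentially. s n / E n \<le> s (u (\<kappa> n)) / E (u (\<kappa> n)) * ((real (\<kappa> n) + 1) / real (\<kappa> n))\<^sup>2"
      using ev by eventually_elim (use sandwich in blast)
  qed (rule filterlim_compose[OF lo \<kappa>] filterlim_compose[OF up \<kappa>])+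
qed

text \<open>
  The first and the last time of each block.  The last time is the predecessor of the first time
  with \<open>E n \<ge> (k + 1)\<^sup>2\<close>.  If \<open>E\<close> jumps over the block, this predecessor comes before \<open>l k\<close>, and
  \<open>E\<close> may be small there; taking the maximum with \<open>l k\<close> keeps \<open>E (u k) \<ge> k\<^sup>2\<close> for every \<open>k\<close>, which is
  what makes the variances along \<open>u\<close> summable.  Both ends of a block are used because increments
  of \<open>E\<close> may be large: the start of the next block need not be comparable to this one.
\<close>

lemma mono_blocks:
  fixes E :: "nat \<Rightarrow> real"
  assumes mono: "mono E" and E: "filterlim E at_top sequentially"
  obtains l u :: "nat \<Rightarrow> nat"
  where "\<And>k. (real k)\<^sup>2 \<le> E (l k)" "\<And>k. (real k)\<^sup>2 \<le> E (u k)"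
    and "\<And>n k. \<lbrakk>(real k)\<^sup>2 \<le> E n; E n < (real k + 1)\<^sup>2\<rbrakk> \<Longrightarrow> l k \<le> n \<and> n \<le> u k \<and> E (u k) \<le> (real k + 1)\<^sup>2"
proof -
  have ex: "\<exists>n. (real k)\<^sup>2 \<le> E n" for k :: nat
    using E by (auto simp: filterlim_at_top eventually_sequentially)
  define l where "l k = (LEAST n. (real k)\<^sup>2 \<le> E n)" for k :: nat
  define u where "u k = max (l k) (l (Suc k) - 1)" for k
  have l: "(real k)\<^sup>2 \<le> E (l k)" for k
    unfolding l_def by (rule LeastI_ex[OF ex])
  have l_le: "l k \<le> n" if "(real k)\<^sup>2 \<le> E n" for k n
    using that unfolding l_def by (intro Least_le)
  have u: "(real k)\<^sup>2 \<le> E (u k)" for k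
    using l[of k] monoD[OF mono, of "l k" "u k"] by (simp add: u_def)
  show thesis
  proof (rule that[of l u, OF l u])
    fix n k assume a: "(real k)\<^sup>2 \<le> E n" "E n < (real k + 1)\<^sup>2"
    have n: "n < l (Suc k)"
    proof (rule ccontr)
      assume "\<not> n < l (Suc k)"
      then have "E (l (Suc k)) \<le> E n" by (intro monoD[OF mono]) simp
      with l[of "Suc k"] a show False by (simp add: add.commute)
    qed
    have "u k < l (Suc k)" using n l_le[OF a(1)] by (auto simp: u_def)
    then have "\<not> (real (Suc k))\<^sup>2 \<le> E (u k)"
      unfolding l_def[of "Suc k"] by (rule not_less_Least)
    then show "l k \<le> n \<and> n \<le> u k \<and> E (u k) \<le> (real k + 1)\<^sup>2"
      using l_le[OF a(1)] n by (simp add: u_def add.commute)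
  qed
qed

text \<open>
  By the variance bound, \<open>S n / E n - 1\<close> has second moment at most \<open>c / E n\<close>.  This is summable
  along any sequence of times \<open>v k\<close> with \<open>E (v k) \<ge> k\<^sup>2\<close>, so the ratio converges almost surely along
  both sequences of block ends, and monotonicity fills the gaps.
\<close>

lemma (in prob_space) AE_partial_sums_over_means_tendsto_1:
  fixes X :: "nat \<Rightarrow> 'a \<Rightarrow> real" and a :: "nat \<Rightarrow> real" and c :: real
  defines "S \<equiv> \<lambda>n x. \<Sum>j<n. X j x" and "E \<equiv> \<lambda>n. \<Sum>j<n. a j"
  assumes meas [measurable]: "\<And>j. X j \<in> borel_measurable M"
    and nonneg: "\<And>j x. 0 \<le> X j x" "\<And>j. 0 \<le> a j"
    and int: "\<And>n. integrable M (\<lambda>x. (S n x - E n)\<^sup>2)"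
    and var: "\<And>n. (\<integral>x. (S n x - E n)\<^sup>2 \<partial>M) \<le> c * E n"
    and E: "filterlim E at_top sequentially"
  shows "AE x in M. (\<lambda>n. S n x / E n) \<longlonglongrightarrow> 1"
proof -
  have monoE: "mono E" unfolding E_def
    by (intro monoI sum_mono2) (auto simp: nonneg)
  have monoS: "mono (\<lambda>n. S n x)" for x unfolding S_def
    by (intro monoI sum_mono2) (auto simp: nonneg)
  have S0: "0 \<le> S n x" for n x unfolding S_def by (intro sum_nonneg nonneg)
  have measS [measurable]: "S n \<in> borel_measurable M" for n unfolding S_def by measurable
  have ratio: "AE x in M. (\<lambda>k. S (v k) x / E (v k)) \<longlonglongrightarrow> 1"
    if v: "\<And>k. (real k)\<^sup>2 \<le> E (v k)" for v :: "nat \<Rightarrow> nat"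
  proof -
    have pos: "0 < E (v (Suc k))" for k
      by (rule less_le_trans[OF _ v]) simp
    have sq: "(S (v (Suc k)) x / E (v (Suc k)) - 1)\<^sup>2
        = (S (v (Suc k)) x - E (v (Suc k)))\<^sup>2 / (E (v (Suc k)))\<^sup>2" for k x
      using pos[of k] by (simp add: power_divide[symmetric] diff_divide_distrib)
    have "AE x in M. (\<lambda>k. S (v (Suc k)) x / E (v (Suc k)) - 1) \<longlonglongrightarrow> 0"
    proof (rule AE_tendsto_zero_of_summable_second_moments)
      show "integrable M (\<lambda>x. (S (v (Suc k)) x / E (v (Suc k)) - 1)\<^sup>2)" for k
        unfolding sq by (intro integrable_divide int)
      show "(\<integral>x. (S (v (Suc k)) x / E (v (Suc k)) - 1)\<^sup>2 \<partial>M) \<le> \<bar>c\<bar> * (1 / (real (Suc k))\<^sup>2)" for k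
      proof -
        have "(\<integral>x. (S (v (Suc k)) x / E (v (Suc k)) - 1)\<^sup>2 \<partial>M)
            = (\<integral>x. (S (v (Suc k)) x - E (v (Suc k)))\<^sup>2 \<partial>M) / (E (v (Suc k)))\<^sup>2"
          unfolding sq by simp
        also have "\<dots> \<le> (\<bar>c\<bar> * E (v (Suc k))) / (E (v (Suc k)))\<^sup>2"
          using pos[of k]
          by (intro divide_right_mono order_trans[OF var]) (auto intro!: mult_right_mono)
        also have "\<dots> = \<bar>c\<bar> * (1 / E (v (Suc k)))"
          by (simp add: power2_eq_square)
        also have "\<dots> \<le> \<bar>c\<bar> * (1 / (real (Suc k))\<^sup>2)"
          using v[of "Suc k"] by (intro mult_left_mono divide_left_mono) (auto intro!: mult_pos_pos pos)
        finally show ?thesis .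
      qed
      have "summable (\<lambda>k. 1 / (real k)\<^sup>2)"
        using inverse_power_summable[of 2, where 'a=real] by (simp add: inverse_eq_divide)
      then have "summable (\<lambda>k. 1 / (real (Suc k))\<^sup>2)"
        by (subst summable_Suc_iff)
      then show "summable (\<lambda>k. \<bar>c\<bar> * (1 / (real (Suc k))\<^sup>2))"
        by (rule summable_mult)
    qed simp
    then show ?thesis
    proof eventually_elim
      case (elim x)
      then have "(\<lambda>k. S (v (Suc k)) x / E (v (Suc k))) \<longlonglongrightarrow> 1"
        by (simp add: LIM_zero_iff)
      then show ?case
        by (rule LIMSEQ_imp_Suc)
    qed
  qed
  obtain l u where lu: "\<And>k. (real k)\<^sup>2 \<le> E (l k)" "\<And>k. (real k)\<^sup>2 \<le> E (u k)"
    and block: "\<And>n k. \<lbrakk>(real k)\<^sup>2 \<le> E n; E n < (real k + 1)\<^sup>2\<rbrakk>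
      \<Longrightarrow> l k \<le> n \<and> n \<le> u k \<and> E (u k) \<le> (real k + 1)\<^sup>2"
    by (rule mono_blocks[OF monoE E]) blast
  from ratio[OF lu(1)] ratio[OF lu(2)] show ?thesis
  proof eventually_elim
    case (elim x)
    show ?case
      by (rule ratio_tendsto_1_of_block_endpoints[OF monoS S0 E elim]) (use block lu in blast)
  qed
qed

text \<open>
  In the variance of a sum each pair of indices is charged to its larger index.  The charges to
  one index form a geometric series, so the variance is bounded by a multiple of the sum of the
  means.
\<close>

lemma (in prob_space) variance_partial_sums_le:
  fixes X :: "nat \<Rightarrow> 'a \<Rightarrow> real" and a :: "nat \<Rightarrow> real"
  assumes int: "\<And>i. integrable M (X i)" and int2: "\<And>i j. integrable M (\<lambda>x. X i x * X j x)"
    and mean: "\<And>i. (\<integral>x. X i x \<partial>M) = a i" and a: "\<And>i. 0 \<le> a i"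
    and cov: "\<And>i d. (\<integral>x. X i x * X (i + d) x \<partial>M) - a i * a (i + d) \<le> K * \<theta> ^ d * a (i + d)"
    and K: "0 \<le> K" and \<theta>: "0 \<le> \<theta>" "\<theta> < 1"
  shows "integrable M (\<lambda>x. ((\<Sum>j<n. X j x) - (\<Sum>j<n. a j))\<^sup>2) \<and>
    (\<integral>x. ((\<Sum>j<n. X j x) - (\<Sum>j<n. a j))\<^sup>2 \<partial>M) \<le> 2 * K / (1 - \<theta>) * (\<Sum>j<n. a j)"
proof -
  define Y where "Y i x = X i x - a i" for i x
  have YY: "Y i x * Y j x = X i x * X j x - a j * X i x - a i * X j x + a i * a j" for i j x
    by (simp add: Y_def algebra_simps)
  have intY: "integrable M (\<lambda>x. Y i x * Y j x)" for i j
    unfolding YY by (simp add: int int2)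
  have "(\<integral>x. Y i x * Y j x \<partial>M) = (\<integral>x. X i x * X j x \<partial>M) - a i * a j" for i j
    unfolding YY by (simp add: int int2 mean prob_space)
  then have covY: "(\<integral>x. Y i x * Y (i + d) x \<partial>M) \<le> K * \<theta> ^ d * a (i + d)" for i d
    using cov[of i d] by simp
  have covY': "(\<integral>x. Y i x * Y n x \<partial>M) \<le> K * \<theta> ^ (n - i) * a n" if "i \<le> n" for i n
    using covY[of i "n - i"] that by simp
  have geo: "(\<Sum>i\<le>n. \<theta> ^ (n - i)) \<le> 1 / (1 - \<theta>)" for n
  proof -
    have "(\<Sum>i\<le>n. \<theta> ^ (n - i)) = (\<Sum>i\<le>n. \<theta> ^ i)"
      by (rule sum.reindex_bij_witness[of _ "\<lambda>i. n - i" "\<lambda>i. n - i"]) auto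
    also have "\<dots> \<le> (\<Sum>i. \<theta> ^ i)"
      using \<theta> by (intro sum_le_suminf summable_geometric) auto
    also have "\<dots> = 1 / (1 - \<theta>)"
      using \<theta> by (intro suminf_geometric) auto
    finally show ?thesis .
  qed
  have D: "(\<Sum>j<n. X j x) - (\<Sum>j<n. a j) = (\<Sum>j<n. Y j x)" for n x
    by (simp add: Y_def sum_subtractf)
  show ?thesis unfolding D
  proof (induction n)
    case (Suc n)
    have sq: "(\<Sum>j<Suc n. Y j x)\<^sup>2 = (\<Sum>j<n. Y j x)\<^sup>2 + (2 * (\<Sum>j<n. Y j x * Y n x) + Y n x * Y n x)" for x
      by (simp add: power2_eq_square sum_distrib_right[symmetric]) (simp add: algebra_simps)
    have int': "integrable M (\<lambda>x. 2 * (\<Sum>j<n. Y j x * Y n x) + Y n x * Y n x)"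
      by (intro Bochner_Integration.integrable_add integrable_mult_right Bochner_Integration.integrable_sum intY)
    have "(\<integral>x. 2 * (\<Sum>j<n. Y j x * Y n x) + Y n x * Y n x \<partial>M)
        = 2 * (\<Sum>j<n. \<integral>x. Y j x * Y n x \<partial>M) + (\<integral>x. Y n x * Y n x \<partial>M)"
      by (simp add: intY Bochner_Integration.integral_add Bochner_Integration.integral_sum Bochner_Integration.integrable_sum)
    also have "\<dots> \<le> 2 * (\<Sum>j\<le>n. \<integral>x. Y j x * Y n x \<partial>M)"
      by (simp add: lessThan_Suc_atMost[symmetric])
    also have "\<dots> \<le> 2 * (\<Sum>j\<le>n. K * \<theta> ^ (n - j) * a n)"
      by (intro mult_left_mono sum_mono covY') auto
    also have "\<dots> = (2 * K * a n) * (\<Sum>j\<le>n. \<theta> ^ (n - j))"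
      by (simp add: sum_distrib_left mult_ac)
    also have "\<dots> \<le> (2 * K * a n) * (1 / (1 - \<theta>))"
      by (intro mult_left_mono geo) (simp add: K a)
    finally have inc: "(\<integral>x. 2 * (\<Sum>j<n. Y j x * Y n x) + Y n x * Y n x \<partial>M)
        \<le> 2 * K / (1 - \<theta>) * a n" by simp
    have "(\<integral>x. (\<Sum>j<Suc n. Y j x)\<^sup>2 \<partial>M) =
        (\<integral>x. (\<Sum>j<n. Y j x)\<^sup>2 \<partial>M) + (\<integral>x. 2 * (\<Sum>j<n. Y j x * Y n x) + Y n x * Y n x \<partial>M)"
      unfolding sq using Suc int' by (intro Bochner_Integration.integral_add) auto
    also have "\<dots> \<le> 2 * K / (1 - \<theta>) * (\<Sum>j<n. a j) + 2 * K / (1 - \<theta>) * a n"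
      by (intro add_mono inc) (use Suc in auto)
    also have "\<dots> = 2 * K / (1 - \<theta>) * (\<Sum>j<Suc n. a j)"
      by (simp add: distrib_left)
    finally show ?case
      unfolding sq using Suc int' by (auto intro!: Bochner_Integration.integrable_add)
  qed simp
qed

section \<open>The skew product over the shift\<close>

text \<open>
  The recursion defining the orbit peels off the last map; to use the invariance of the skew
  product, it is the first map that has to be peeled off.
\<close>

lemma random_orbit_Suc_shift:
  "random_orbit T w (Suc n) x = random_orbit T (\<lambda>k. w (Suc k)) n (T (w 0) x)"
  by (induction n) auto

lemma random_orbit_case_nat:
  "random_orbit T (case_nat \<omega> w) (Suc n) x = random_orbit T w n (T \<omega> x)"
  by (simp add: random_orbit_Suc_shift del: random_orbit.simps)

locale stationary_random_system = Pr: prob_space Pr + \<mu>: prob_space \<mu>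
  for Pr :: "'w measure" and \<mu> :: "'x measure" +
  fixes T :: "'w \<Rightarrow> 'x \<Rightarrow> 'x"
  assumes T_measurable: "(\<lambda>(\<omega>, x). T \<omega> x) \<in> measurable (Pr \<Otimes>\<^sub>M \<mu>) \<mu>"
    and stationary: "stationary Pr T \<mu>"
begin

abbreviation "Q \<equiv> \<Pi>\<^sub>M i\<in>(UNIV :: nat set). Pr"

sublocale Q: sequence_space Pr
  by unfold_locales

sublocale Q\<mu>: pair_prob_space Q \<mu>
  by unfold_locales

sublocale Pr\<mu>: pair_prob_space Pr \<mu>
  by unfold_locales

sublocale \<mu>Pr: pair_prob_space \<mu> Pr
  by unfold_locales

lemma T_measurable' [measurable (raw)]:
  assumes "f \<in> measurable N Pr" "g \<in> measurable N \<mu>"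
  shows "(\<lambda>y. T (f y) (g y)) \<in> measurable N \<mu>"
  using measurable_compose[OF measurable_Pair[OF assms] T_measurable] by simp

lemma random_orbit_measurable [measurable (raw)]:
  assumes [measurable]: "f \<in> measurable N Q" "g \<in> measurable N \<mu>"
  shows "(\<lambda>y. random_orbit T (f y) n (g y)) \<in> measurable N \<mu>"
proof (induction n)
  case (Suc n)
  note Suc [measurable]
  have "(\<lambda>y. f y n) \<in> measurable N Pr" by measurable
  then show ?case by simp
qed simp

lemma distr_T: "distr (\<mu> \<Otimes>\<^sub>M Pr) \<mu> (\<lambda>(x, \<omega>). T \<omega> x) = \<mu>"
proof (rule measure_eqI)
  fix A assume "A \<in> sets (distr (\<mu> \<Otimes>\<^sub>M Pr) \<mu> (\<lambda>(x, \<omega>). T \<omega> x))"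
  then have A [measurable]: "A \<in> sets \<mu>" by simp
  have "emeasure (distr (\<mu> \<Otimes>\<^sub>M Pr) \<mu> (\<lambda>(x, \<omega>). T \<omega> x)) A
      = emeasure (\<mu> \<Otimes>\<^sub>M Pr) ((\<lambda>(x, \<omega>). T \<omega> x) -` A \<inter> space (\<mu> \<Otimes>\<^sub>M Pr))"
    by (rule emeasure_distr) measurable
  also have "\<dots> = (\<integral>\<^sup>+\<omega>. emeasure \<mu> ((\<lambda>x. (x, \<omega>)) -` ((\<lambda>(x, \<omega>). T \<omega> x) -` A \<inter> space (\<mu> \<Otimes>\<^sub>M Pr))) \<partial>Pr)"
    by (rule \<mu>Pr.emeasure_pair_measure_alt2) measurable
  also have "\<dots> = (\<integral>\<^sup>+\<omega>. emeasure \<mu> (T \<omega> -` A \<inter> space \<mu>) \<partial>Pr)"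
    by (intro nn_integral_cong arg_cong[where f="emeasure \<mu>"]) (auto simp: space_pair_measure)
  also have "\<dots> = emeasure \<mu> A"
    using stationary A by (simp add: stationary_def)
  finally show "emeasure (distr (\<mu> \<Otimes>\<^sub>M Pr) \<mu> (\<lambda>(x, \<omega>). T \<omega> x)) A = emeasure \<mu> A" .
qed simp

lemma nn_integral_T:
  assumes [measurable]: "g \<in> borel_measurable \<mu>"
  shows "(\<integral>\<^sup>+\<omega>. \<integral>\<^sup>+x. g (T \<omega> x) \<partial>\<mu> \<partial>Pr) = (\<integral>\<^sup>+x. g x \<partial>\<mu>)"
proof -
  have "(\<integral>\<^sup>+x. g x \<partial>\<mu>) = (\<integral>\<^sup>+p. g (case p of (x, \<omega>) \<Rightarrow> T \<omega> x) \<partial>(\<mu> \<Otimes>\<^sub>M Pr))"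
    by (subst distr_T[symmetric], subst nn_integral_distr) auto
  also have "\<dots> = (\<integral>\<^sup>+\<omega>. \<integral>\<^sup>+x. g (T \<omega> x) \<partial>\<mu> \<partial>Pr)"
    by (subst \<mu>Pr.nn_integral_snd[symmetric]) auto
  finally show ?thesis ..
qed

lemma AE_T:
  assumes "AE y in \<mu>. P y"
  shows "AE x in \<mu>. AE \<omega> in Pr. P (T \<omega> x)"
proof -
  have "AE y in distr (\<mu> \<Otimes>\<^sub>M Pr) \<mu> (\<lambda>(x, \<omega>). T \<omega> x). P y"
    unfolding distr_T by (rule assms)
  then have "AE p in \<mu> \<Otimes>\<^sub>M Pr. P (case p of (x, \<omega>) \<Rightarrow> T \<omega> x)"
    by (rule AE_distrD[rotated]) measurable
  from \<mu>Pr.AE_pair[OF this] show ?thesis by simp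
qed

text \<open>
  The law of a random sequence is that of a letter followed by an independent copy of the
  sequence.
\<close>

lemma nn_integral_case_nat:
  assumes [measurable]: "G \<in> borel_measurable Q"
  shows "(\<integral>\<^sup>+w. G w \<partial>Q) = (\<integral>\<^sup>+\<omega>. \<integral>\<^sup>+w. G (case_nat \<omega> w) \<partial>Q \<partial>Pr)"
proof -
  have "(\<integral>\<^sup>+w. G w \<partial>Q) = (\<integral>\<^sup>+p. G (case p of (\<omega>, w) \<Rightarrow> case_nat \<omega> w) \<partial>(Pr \<Otimes>\<^sub>M Q))"
    by (subst Q.PiM_iter[symmetric], subst nn_integral_distr) auto
  also have "\<dots> = (\<integral>\<^sup>+\<omega>. \<integral>\<^sup>+w. G (case_nat \<omega> w) \<partial>Q \<partial>Pr)"
    by (subst Q.P.nn_integral_fst[symmetric]) auto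
  finally show ?thesis .
qed

text \<open>
  The skew product \<open>(w, x) \<mapsto> (shift w, T (w 0) x)\<close> preserves the product measure: the first letter
  is independent of the shifted sequence, and averaging \<open>T \<omega> x\<close> over this letter and over \<open>x\<close>
  returns \<open>\<mu>\<close> by stationarity.
\<close>

lemma nn_integral_skew_product:
  assumes F [measurable]: "F \<in> borel_measurable (Q \<Otimes>\<^sub>M \<mu>)"
  shows "(\<integral>\<^sup>+(w, x). F (\<lambda>k. w (Suc k), T (w 0) x) \<partial>(Q \<Otimes>\<^sub>M \<mu>)) = (\<integral>\<^sup>+p. F p \<partial>(Q \<Otimes>\<^sub>M \<mu>))"
proof -
  have shift [measurable]: "(\<lambda>w k. w (Suc k)) \<in> measurable Q Q"
    by (rule measurable_PiM_single') (auto simp: space_PiM)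
  have "(\<integral>\<^sup>+(w, x). F (\<lambda>k. w (Suc k), T (w 0) x) \<partial>(Q \<Otimes>\<^sub>M \<mu>))
      = (\<integral>\<^sup>+x. \<integral>\<^sup>+w. F (\<lambda>k. w (Suc k), T (w 0) x) \<partial>Q \<partial>\<mu>)"
    by (subst Q\<mu>.nn_integral_snd[symmetric]) (auto intro!: measurable_compose[OF _ shift])
  also have "\<dots> = (\<integral>\<^sup>+x. \<integral>\<^sup>+\<omega>. \<integral>\<^sup>+w. F (w, T \<omega> x) \<partial>Q \<partial>Pr \<partial>\<mu>)"
    by (intro nn_integral_cong, subst nn_integral_case_nat) (auto intro!: measurable_compose[OF _ shift])
  also have "\<dots> = (\<integral>\<^sup>+\<omega>. \<integral>\<^sup>+x. \<integral>\<^sup>+w. F (w, T \<omega> x) \<partial>Q \<partial>\<mu> \<partial>Pr)"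
    by (rule Pr\<mu>.Fubini') measurable
  also have "\<dots> = (\<integral>\<^sup>+x. \<integral>\<^sup>+w. F (w, x) \<partial>Q \<partial>\<mu>)"
    by (rule nn_integral_T) measurable
  also have "\<dots> = (\<integral>\<^sup>+p. F p \<partial>(Q \<Otimes>\<^sub>M \<mu>))"
    by (rule Q\<mu>.nn_integral_snd) measurable
  finally show ?thesis .
qed

lemma nn_integral_orbit_shift:
  assumes [measurable]: "f \<in> borel_measurable \<mu>" "g \<in> borel_measurable \<mu>"
  shows "(\<integral>\<^sup>+(w, x). f (random_orbit T w i x) * g (random_orbit T w (i + d) x) \<partial>(Q \<Otimes>\<^sub>M \<mu>))
    = (\<integral>\<^sup>+(w, x). f x * g (random_orbit T w d x) \<partial>(Q \<Otimes>\<^sub>M \<mu>))"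
proof (induction i)
  case (Suc i)
  have "(\<integral>\<^sup>+(w, x). f (random_orbit T w (Suc i) x) * g (random_orbit T w (Suc i + d) x) \<partial>(Q \<Otimes>\<^sub>M \<mu>))
    = (\<integral>\<^sup>+(w, x). (\<lambda>(w, x). f (random_orbit T w i x) * g (random_orbit T w (i + d) x))
          (\<lambda>k. w (Suc k), T (w 0) x) \<partial>(Q \<Otimes>\<^sub>M \<mu>))"
    by (simp add: random_orbit_Suc_shift del: random_orbit.simps)
  also have "\<dots> = (\<integral>\<^sup>+(w, x). f (random_orbit T w i x) * g (random_orbit T w (i + d) x) \<partial>(Q \<Otimes>\<^sub>M \<mu>))"
    by (rule nn_integral_skew_product) measurable
  finally show ?case using Suc.IH by simp
qed simp

lemma distr_random_orbit: "distr (Q \<Otimes>\<^sub>M \<mu>) \<mu> (\<lambda>(w, x). random_orbit T w n x) = \<mu>"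
proof (rule measure_eqI)
  fix A assume "A \<in> sets (distr (Q \<Otimes>\<^sub>M \<mu>) \<mu> (\<lambda>(w, x). random_orbit T w n x))"
  then have A [measurable]: "A \<in> sets \<mu>" by simp
  have "emeasure (distr (Q \<Otimes>\<^sub>M \<mu>) \<mu> (\<lambda>(w, x). random_orbit T w n x)) A
      = (\<integral>\<^sup>+y. indicator A y \<partial>distr (Q \<Otimes>\<^sub>M \<mu>) \<mu> (\<lambda>(w, x). random_orbit T w n x))"
    by simp
  also have "\<dots> = (\<integral>\<^sup>+(w, x). indicator A (random_orbit T w n x) * 1 \<partial>(Q \<Otimes>\<^sub>M \<mu>))"
    by (subst nn_integral_distr) (auto simp: split_beta')
  also have "\<dots> = (\<integral>\<^sup>+(w, x). indicator A x * 1 \<partial>(Q \<Otimes>\<^sub>M \<mu>))"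
    using nn_integral_orbit_shift[of "indicator A" "\<lambda>_. 1" n 0] by simp
  also have "\<dots> = (\<integral>\<^sup>+w. \<integral>\<^sup>+x. indicator A x \<partial>\<mu> \<partial>Q)"
    by (subst \<mu>.nn_integral_fst[symmetric]) auto
  also have "\<dots> = emeasure \<mu> A"
    using Q.P.emeasure_space_1 by simp
  finally show "emeasure (distr (Q \<Otimes>\<^sub>M \<mu>) \<mu> (\<lambda>(w, x). random_orbit T w n x)) A = emeasure \<mu> A" .
qed simp

lemma AE_random_orbit:
  assumes "AE y in \<mu>. P y"
  shows "AE (w, x) in Q \<Otimes>\<^sub>M \<mu>. P (random_orbit T w n x)"
proof -
  have "AE y in distr (Q \<Otimes>\<^sub>M \<mu>) \<mu> (\<lambda>(w, x). random_orbit T w n x). P y"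
    unfolding distr_random_orbit by (rule assms)
  then have "AE p in Q \<Otimes>\<^sub>M \<mu>. P (case p of (w, x) \<Rightarrow> random_orbit T w n x)"
    by (rule AE_distrD[rotated]) measurable
  then show ?thesis by (simp add: split_beta')
qed

section \<open>Correlations along the orbit\<close>

lemma koopman_measurable [measurable]:
  assumes [measurable]: "g \<in> borel_measurable \<mu>"
  shows "koopman Pr T g \<in> borel_measurable \<mu>"
  unfolding koopman_def by measurable

lemma koopman_funpow_measurable [measurable]:
  assumes "g \<in> borel_measurable \<mu>"
  shows "(koopman Pr T ^^ n) g \<in> borel_measurable \<mu>"
  using assms by (induction n) auto

text \<open>
  The iterated Koopman operator is the conditional expectation of \<open>g\<close> along the orbit, given the
  starting point: the first letter of the sequence is averaged by the outermost application of
  the operator.  The equality is only almost everywhere, since a Bochner integral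
  is \<open>0\<close> where \<open>g\<close> along the orbit is not integrable, and this value would be fed into the next
  iterate.
\<close>

lemma AE_koopman_funpow:
  fixes g :: "'x \<Rightarrow> real"
  assumes g [measurable]: "integrable \<mu> g" and nonneg: "\<And>x. 0 \<le> g x"
  shows "AE x in \<mu>. (\<integral>\<^sup>+w. ennreal (g (random_orbit T w n x)) \<partial>Q) < \<infinity> \<and>
    (koopman Pr T ^^ n) (\<lambda>x. complex_of_real (g x)) x
      = complex_of_real (enn2real (\<integral>\<^sup>+w. ennreal (g (random_orbit T w n x)) \<partial>Q))"
proof -
  define N where "N n x = (\<integral>\<^sup>+w. ennreal (g (random_orbit T w n x)) \<partial>Q)" for n x
  have N_meas [measurable]: "N n \<in> borel_measurable \<mu>" for n unfolding N_def by measurable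
  have finite: "AE x in \<mu>. N n x \<noteq> \<infinity>" for n
  proof (rule nn_integral_PInf_AE)
    have "(\<integral>\<^sup>+x. N n x \<partial>\<mu>) = (\<integral>\<^sup>+p. ennreal (g (case p of (w, x) \<Rightarrow> random_orbit T w n x)) \<partial>(Q \<Otimes>\<^sub>M \<mu>))"
      unfolding N_def by (subst Q\<mu>.nn_integral_snd[symmetric]) auto
    also have "\<dots> = (\<integral>\<^sup>+x. ennreal (g x) \<partial>\<mu>)"
      by (subst (2) distr_random_orbit[of n, symmetric], subst nn_integral_distr) auto
    also have "\<dots> \<noteq> \<infinity>"
      using g by (simp add: nn_integral_eq_integral nonneg)
    finally show "(\<integral>\<^sup>+x. N n x \<partial>\<mu>) \<noteq> \<infinity>" .
  qed simp
  have N_Suc: "N (Suc n) x = (\<integral>\<^sup>+\<omega>. N n (T \<omega> x) \<partial>Pr)" if [measurable]: "x \<in> space \<mu>" for n x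
    unfolding N_def
    by (subst nn_integral_case_nat) (simp_all add: random_orbit_case_nat del: random_orbit.simps)
  have "AE x in \<mu>. (koopman Pr T ^^ n) (\<lambda>x. complex_of_real (g x)) x = complex_of_real (enn2real (N n x))"
  proof (induction n)
    case 0
    then show ?case
      using Q.P.emeasure_space_1 by (simp add: N_def nonneg)
  next
    case (Suc n)
    from AE_T[OF Suc.IH] AE_T[OF finite[of n]] AE_space show ?case
    proof eventually_elim
      case (elim x)
      note [measurable] = \<open>x \<in> space \<mu>\<close>
      have "(koopman Pr T ^^ Suc n) (\<lambda>x. complex_of_real (g x)) x
          = (\<integral>\<omega>. (koopman Pr T ^^ n) (\<lambda>x. complex_of_real (g x)) (T \<omega> x) \<partial>Pr)"
        by (simp add: koopman_def)
      also have "\<dots> = (\<integral>\<omega>. complex_of_real (enn2real (N n (T \<omega> x))) \<partial>Pr)"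
        by (rule integral_cong_AE) (use elim in auto)
      also have "\<dots> = complex_of_real (\<integral>\<omega>. enn2real (N n (T \<omega> x)) \<partial>Pr)"
        by simp
      also have "(\<integral>\<omega>. enn2real (N n (T \<omega> x)) \<partial>Pr) = enn2real (\<integral>\<^sup>+\<omega>. ennreal (enn2real (N n (T \<omega> x))) \<partial>Pr)"
        by (rule integral_eq_nn_integral) auto
      also have "(\<integral>\<^sup>+\<omega>. ennreal (enn2real (N n (T \<omega> x))) \<partial>Pr) = (\<integral>\<^sup>+\<omega>. N n (T \<omega> x) \<partial>Pr)"
        by (rule nn_integral_cong_AE) (use elim(2) in \<open>auto simp: less_top\<close>)
      also have "\<dots> = N (Suc n) x"
        using N_Suc[of x n] elim by simp
      finally show ?case .
    qed
  qed
  with finite[of n] show ?thesis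
    unfolding N_def by eventually_elim (simp add: less_top)
qed

text \<open>
  Joint moments of two observables along the orbit reduce to \<open>\<integral> f \<cdot> U\<^sup>d g d\<mu>\<close>: invariance of
  the skew product moves the earlier time to \<open>0\<close>, and Tonelli's theorem averages \<open>g\<close> over the
  letters and turns the integrability of \<open>f \<cdot> U\<^sup>d g\<close> into that of the joint product.
\<close>

lemma integral_orbit_product:
  fixes f g :: "'x \<Rightarrow> real"
  assumes f [measurable]: "f \<in> borel_measurable \<mu>" "\<And>x. 0 \<le> f x"
    and g: "integrable \<mu> g" "\<And>x. 0 \<le> g x"
    and int: "integrable \<mu> (\<lambda>x. complex_of_real (f x) * (koopman Pr T ^^ d) (\<lambda>x. complex_of_real (g x)) x)"
  shows "integrable (Q \<Otimes>\<^sub>M \<mu>) (\<lambda>(w, x). f (random_orbit T w i x) * g (random_orbit T w (i + d) x))"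
    and "complex_of_real (\<integral>(w, x). f (random_orbit T w i x) * g (random_orbit T w (i + d) x) \<partial>(Q \<Otimes>\<^sub>M \<mu>))
      = (\<integral>x. complex_of_real (f x) * (koopman Pr T ^^ d) (\<lambda>x. complex_of_real (g x)) x \<partial>\<mu>)"
proof -
  have [measurable]: "g \<in> borel_measurable \<mu>" using g by auto
  define N where "N x = (\<integral>\<^sup>+w. ennreal (g (random_orbit T w d x)) \<partial>Q)" for x
  have [measurable]: "N \<in> borel_measurable \<mu>" unfolding N_def by measurable
  define h where "h x = f x * enn2real (N x)" for x
  have h0: "0 \<le> h x" for x unfolding h_def using f(2) by simp
  have [measurable]: "h \<in> borel_measurable \<mu>" unfolding h_def by measurable
  have AE: "AE x in \<mu>. N x < \<infinity> \<and>
      complex_of_real (f x) * (koopman Pr T ^^ d) (\<lambda>x. complex_of_real (g x)) x = complex_of_real (h x)"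
    using AE_koopman_funpow[OF g, of d] unfolding N_def h_def by eventually_elim simp
  have "integrable \<mu> (\<lambda>x. complex_of_real (h x))"
    by (rule integrable_cong_AE_imp[OF int]) (use AE in auto)
  then have inth: "integrable \<mu> h"
    by (simp add: complex_of_real_integrable_eq)
  have inteq: "(\<integral>x. complex_of_real (f x) * (koopman Pr T ^^ d) (\<lambda>x. complex_of_real (g x)) x \<partial>\<mu>)
      = complex_of_real (\<integral>x. h x \<partial>\<mu>)"
    unfolding integral_complex_of_real[symmetric] by (rule integral_cong_AE) (use AE in auto)
  have "(\<integral>\<^sup>+p. ennreal (case p of (w, x) \<Rightarrow> f (random_orbit T w i x) * g (random_orbit T w (i + d) x)) \<partial>(Q \<Otimes>\<^sub>M \<mu>))
    = (\<integral>\<^sup>+(w, x). ennreal (f x) * ennreal (g (random_orbit T w d x)) \<partial>(Q \<Otimes>\<^sub>M \<mu>))"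
    using nn_integral_orbit_shift[of "\<lambda>x. ennreal (f x)" "\<lambda>x. ennreal (g x)" i d]
    by (simp add: ennreal_mult f g split_beta')
  also have "\<dots> = (\<integral>\<^sup>+x. ennreal (f x) * N x \<partial>\<mu>)"
    unfolding N_def by (subst Q\<mu>.nn_integral_snd[symmetric]) (auto intro!: nn_integral_cong nn_integral_cmult)
  also have "\<dots> = (\<integral>\<^sup>+x. ennreal (h x) \<partial>\<mu>)"
    unfolding h_def by (rule nn_integral_cong_AE) (use AE in \<open>auto simp: ennreal_mult f less_top\<close>)
  also have "\<dots> = ennreal (\<integral>x. h x \<partial>\<mu>)"
    by (rule nn_integral_eq_integral[OF inth]) (simp add: h0)
  finally have *: "(\<integral>\<^sup>+p. ennreal (case p of (w, x) \<Rightarrow> f (random_orbit T w i x) * g (random_orbit T w (i + d) x)) \<partial>(Q \<Otimes>\<^sub>M \<mu>))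
    = ennreal (\<integral>x. h x \<partial>\<mu>)" .
  show "integrable (Q \<Otimes>\<^sub>M \<mu>) (\<lambda>(w, x). f (random_orbit T w i x) * g (random_orbit T w (i + d) x))"
    by (rule integrableI_nn_integral_finite[OF _ _ *]) (auto simp: f g)
  have "(\<integral>(w, x). f (random_orbit T w i x) * g (random_orbit T w (i + d) x) \<partial>(Q \<Otimes>\<^sub>M \<mu>)) = (\<integral>x. h x \<partial>\<mu>)"
    by (subst integral_eq_nn_integral) (auto simp: * f g intro!: enn2real_ennreal Bochner_Integration.integral_nonneg h0)
  then show "complex_of_real (\<integral>(w, x). f (random_orbit T w i x) * g (random_orbit T w (i + d) x) \<partial>(Q \<Otimes>\<^sub>M \<mu>))
      = (\<integral>x. complex_of_real (f x) * (koopman Pr T ^^ d) (\<lambda>x. complex_of_real (g x)) x \<partial>\<mu>)"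
    using inteq by simp
qed

end

section \<open>Systems with decay of correlations\<close>

context decaying_random_system
begin

lemma prob_space_mu: "prob_space \<mu>"
  and sets_mu: "sets \<mu> = sets m"
  and absolutely_continuous_mu: "absolutely_continuous m \<mu>"
  using mu_ac_stationary by (auto simp: ac_stationary_def)

lemma AE_mu: "AE x in m. P x \<Longrightarrow> AE x in \<mu>. P x"
  by (rule absolutely_continuous_AE[OF _ absolutely_continuous_mu]) (simp_all add: sets_mu)

lemma stationary_random_system: "stationary_random_system Pr \<mu> T"
proof (intro stationary_random_system.intro stationary_random_system_axioms.intro)
  show "prob_space Pr" by (rule Pr.prob_space_axioms)
  show "prob_space \<mu>" by (rule prob_space_mu)
  show "(\<lambda>(\<omega>, x). T \<omega> x) \<in> measurable (Pr \<Otimes>\<^sub>M \<mu>) \<mu>"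
    using T_measurable by (simp add: sets_mu cong: measurable_cong_sets sets_pair_measure_cong)
  show "stationary Pr T \<mu>"
    using mu_ac_stationary by (simp add: ac_stationary_def)
qed

sublocale S: stationary_random_system Pr \<mu> T
  by (rule stationary_random_system)

text \<open>
  The rate may be taken nonnegative: a negative one is refuted by \<open>n = 1\<close> and \<open>f = g = 1\<close>, where
  the bound has the sign of \<open>\<theta>\<close> because \<open>nB 1 > 0\<close>.
\<close>

lemma decay_rate:
  obtains C \<theta> where "0 < C" "0 \<le> \<theta>" "\<theta> < 1"
    and "\<And>n f g. \<lbrakk>f \<in> B; integrable \<mu> g\<rbrakk> \<Longrightarrow> integrable \<mu> (\<lambda>x. f x * (koopman Pr T ^^ n) g x)"
    and "\<And>n f g. \<lbrakk>f \<in> B; integrable \<mu> g\<rbrakk> \<Longrightarrow>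
      cmod ((\<integral>x. f x * (koopman Pr T ^^ n) g x \<partial>\<mu>) - (\<integral>x. f x \<partial>\<mu>) * (\<integral>x. g x \<partial>\<mu>))
          \<le> C * \<theta> ^ n * nB f * (\<integral>x. cmod (g x) \<partial>\<mu>)"
proof -
  from decay obtain C \<theta> where C: "0 < C" and \<theta>: "\<theta> < 1"
    and int: "\<And>n f g. \<lbrakk>f \<in> B; integrable \<mu> g\<rbrakk> \<Longrightarrow> integrable \<mu> (\<lambda>x. f x * (koopman Pr T ^^ n) g x)"
    and bound: "\<And>n f g. \<lbrakk>f \<in> B; integrable \<mu> g\<rbrakk> \<Longrightarrow>
      cmod ((\<integral>x. f x * (koopman Pr T ^^ n) g x \<partial>\<mu>) - (\<integral>x. f x \<partial>\<mu>) * (\<integral>x. g x \<partial>\<mu>))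
          \<le> C * \<theta> ^ n * nB f * (\<integral>x. cmod (g x) \<partial>\<mu>)"
    unfolding decay_of_correlations_def by blast
  have "\<not> (AE x in m. (1::complex) = 0)"
    by simp
  then have "nB (\<lambda>_. 1) \<noteq> 0"
    using norm_zero[OF const_mem[of 1]] by simp
  then have pos: "0 < nB (\<lambda>_. 1)"
    using norm_nonneg[OF const_mem[of 1]] by simp
  have "0 \<le> C * \<theta> ^ 1 * nB (\<lambda>_. 1) * (\<integral>x. cmod 1 \<partial>\<mu>)"
    by (rule order_trans[OF norm_ge_zero bound[OF const_mem, of "\<lambda>_. 1" 1 1]]) simp
  then have "0 \<le> C * nB (\<lambda>_. 1) * \<theta>"
    by (simp add: mult_ac S.\<mu>.prob_space)
  then have "0 \<le> \<theta>"
    using mult_pos_pos[OF C pos] by (simp add: zero_le_mult_iff)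
  then show thesis using that C \<theta> int bound by blast
qed

lemma integrable_mu:
  assumes "f \<in> B" shows "integrable \<mu> f"
proof -
  from decay have "integrable \<mu> (\<lambda>x. f x * (koopman Pr T ^^ 0) (\<lambda>_. 1) x)"
    unfolding decay_of_correlations_def using assms S.\<mu>.integrable_const by blast
  then show ?thesis by simp
qed

end

theorem proposition5p2:
  fixes Pr :: "'w measure" and m :: "'x measure" and T :: "'w \<Rightarrow> 'x \<Rightarrow> 'x"
    and B :: "('x \<Rightarrow> complex) set" and nB :: "('x \<Rightarrow> complex) \<Rightarrow> real"
    and \<mu> :: "'x measure" and \<phi> :: "nat \<Rightarrow> 'x \<Rightarrow> real" and E :: "nat \<Rightarrow> real"
  assumes "decaying_random_system Pr m T B nB \<mu>"
    and "\<And>n. (\<lambda>x. complex_of_real (\<phi> n x)) \<in> B"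
    and "\<And>n. AE x in m. 0 \<le> \<phi> n x"
    and "bdd_above (range (\<lambda>n. nB (\<lambda>x. complex_of_real (\<phi> n x))))"
    and "\<And>n. E n = (\<Sum>j<n. \<integral>x. \<phi> j x \<partial>\<mu>)"
    and "filterlim E at_top sequentially"
  shows "AE (w, x) in (\<Pi>\<^sub>M i\<in>(UNIV :: nat set). Pr) \<Otimes>\<^sub>M \<mu>.
           (\<lambda>n. (1 / E n) * (\<Sum>j<n. \<phi> j (random_orbit T w j x))) \<longlonglongrightarrow> 1"
proof -
  interpret decaying_random_system Pr m T B nB \<mu> by (rule assms(1))
  obtain C \<theta> where C: "0 < C" and \<theta>: "0 \<le> \<theta>" "\<theta> < 1"
    and int: "\<And>n f g. \<lbrakk>f \<in> B; integrable \<mu> g\<rbrakk> \<Longrightarrow> integrable \<mu> (\<lambda>x. f x * (koopman Pr T ^^ n) g x)"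
    and decay: "\<And>n f g. \<lbrakk>f \<in> B; integrable \<mu> g\<rbrakk> \<Longrightarrow>
      cmod ((\<integral>x. f x * (koopman Pr T ^^ n) g x \<partial>\<mu>) - (\<integral>x. f x \<partial>\<mu>) * (\<integral>x. g x \<partial>\<mu>))
          \<le> C * \<theta> ^ n * nB f * (\<integral>x. cmod (g x) \<partial>\<mu>)"
    by (rule decay_rate) blast
  obtain R where R: "\<And>n. nB (\<lambda>x. complex_of_real (\<phi> n x)) \<le> R"
    using assms(4) by (auto simp: bdd_above_def)
  \<comment> \<open>The functions \<open>\<phi> n\<close> are replaced by versions that are nonnegative everywhere, without leaving \<open>B\<close>.\<close>
  define \<psi> where "\<psi> n x = max 0 (\<phi> n x)" for n x
  have \<psi>0: "0 \<le> \<psi> n x" for n x by (simp add: \<psi>_def)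
  have \<phi>_meas_m [measurable]: "\<phi> n \<in> borel_measurable m" for n
    using subset_L1[OF assms(2)[of n]] by (simp add: complex_of_real_integrable_eq)
  then have \<phi>_meas [measurable]: "\<phi> n \<in> borel_measurable \<mu>" for n
    by (simp add: sets_mu cong: measurable_cong_sets)
  have \<psi>_meas_m: "\<psi> n \<in> borel_measurable m" for n unfolding \<psi>_def by measurable
  have \<psi>_meas [measurable]: "\<psi> n \<in> borel_measurable \<mu>" for n unfolding \<psi>_def by measurable
  have eq: "AE x in m. \<phi> n x = \<psi> n x" for n
    using assms(3)[of n] by eventually_elim (simp add: \<psi>_def)
  have \<psi>B: "(\<lambda>x. complex_of_real (\<psi> n x)) \<in> B \<and>
      nB (\<lambda>x. complex_of_real (\<psi> n x)) = nB (\<lambda>x. complex_of_real (\<phi> n x))" for n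
    using eq[of n] \<psi>_meas_m by (intro saturated[OF assms(2)]) auto
  have \<psi>_int: "integrable \<mu> (\<psi> n)" for n
    using integrable_mu[of "\<lambda>x. complex_of_real (\<psi> n x)"] \<psi>B by (simp add: complex_of_real_integrable_eq)
  define a where "a n = (\<integral>x. \<psi> n x \<partial>\<mu>)" for n
  have a0: "0 \<le> a n" for n unfolding a_def by (simp add: \<psi>0)
  have E: "E = (\<lambda>n. \<Sum>j<n. a j)"
    unfolding a_def assms(5) by (intro ext sum.cong refl integral_cong_AE AE_mu eq) auto
  define X where "X n = (\<lambda>(w, x). \<psi> n (random_orbit T w n x))" for n
  have X_meas [measurable]: "X n \<in> borel_measurable (S.Q \<Otimes>\<^sub>M \<mu>)" for n unfolding X_def by measurable
  have X0: "0 \<le> X n p" for n p by (simp add: X_def \<psi>0 split_beta')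
  have X_law: "integrable (S.Q \<Otimes>\<^sub>M \<mu>) (X n) \<and> (\<integral>p. X n p \<partial>(S.Q \<Otimes>\<^sub>M \<mu>)) = a n" for n
  proof -
    have orbit: "(\<lambda>(w, x). random_orbit T w n x) \<in> measurable (S.Q \<Otimes>\<^sub>M \<mu>) \<mu>" by measurable
    have X: "X n = (\<lambda>p. \<psi> n (case p of (w, x) \<Rightarrow> random_orbit T w n x))"
      by (auto simp: X_def)
    show ?thesis
      unfolding X a_def
      using integrable_distr_eq[OF orbit \<psi>_meas, of n] integral_distr[OF orbit \<psi>_meas, of n] \<psi>_int[of n]
      by (simp add: S.distr_random_orbit)
  qed
  have XX: "integrable (S.Q \<Otimes>\<^sub>M \<mu>) (\<lambda>p. X i p * X (i + d) p) \<and>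
      (\<integral>p. X i p * X (i + d) p \<partial>(S.Q \<Otimes>\<^sub>M \<mu>)) - a i * a (i + d) \<le> C * R * \<theta> ^ d * a (i + d)" for i d
  proof -
    let ?f = "\<lambda>x. complex_of_real (\<psi> i x)" and ?g = "\<lambda>x. complex_of_real (\<psi> (i + d) x)"
    have f: "?f \<in> B" and g: "integrable \<mu> ?g" using \<psi>B integrable_mu by auto
    have XX: "(\<lambda>p. X i p * X (i + d) p)
        = (\<lambda>(w, x). \<psi> i (random_orbit T w i x) * \<psi> (i + d) (random_orbit T w (i + d) x))"
      by (auto simp: X_def)
    \<comment> \<open>The earlier factor plays \<open>f\<close> (measured by \<open>nB\<close>) and the later one \<open>g\<close>, measured in \<open>L\<^sup>1(\<mu>)\<close>.\<close>
    note prod = S.integral_orbit_product[OF \<psi>_meas \<psi>0 \<psi>_int \<psi>0 int[OF f g], of i]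
    let ?I = "\<integral>p. X i p * X (i + d) p \<partial>(S.Q \<Otimes>\<^sub>M \<mu>)"
    have "cmod (complex_of_real ?I - complex_of_real (a i) * complex_of_real (a (i + d)))
        \<le> C * \<theta> ^ d * nB ?f * a (i + d)"
      using decay[OF f g, of d] unfolding XX prod(2) by (simp add: a_def \<psi>0)
    also have "complex_of_real ?I - complex_of_real (a i) * complex_of_real (a (i + d))
        = complex_of_real (?I - a i * a (i + d))" by simp
    finally have "?I - a i * a (i + d) \<le> C * \<theta> ^ d * nB ?f * a (i + d)"
      unfolding norm_of_real by linarith
    also have "\<dots> \<le> C * \<theta> ^ d * R * a (i + d)"
      using C \<theta> a0 R \<psi>B by (intro mult_right_mono mult_left_mono) auto
    finally show ?thesis
      using prod(1) by (simp add: XX mult_ac)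
  qed
  have XX_int: "integrable (S.Q \<Otimes>\<^sub>M \<mu>) (\<lambda>p. X i p * X j p)" for i j
    using XX[of i "j - i"] XX[of j "i - j"] by (cases "i \<le> j") (auto simp: mult.commute)
  have "0 \<le> R" using R[of 0] norm_nonneg[OF assms(2)[of 0]] by linarith
  then have "0 \<le> C * R" using C by simp
  have var: "integrable (S.Q \<Otimes>\<^sub>M \<mu>) (\<lambda>p. ((\<Sum>j<n. X j p) - (\<Sum>j<n. a j))\<^sup>2) \<and>
    (\<integral>p. ((\<Sum>j<n. X j p) - (\<Sum>j<n. a j))\<^sup>2 \<partial>(S.Q \<Otimes>\<^sub>M \<mu>)) \<le> 2 * (C * R) / (1 - \<theta>) * (\<Sum>j<n. a j)" for n
    by (rule S.Q\<mu>.variance_partial_sums_le) (use X_law XX XX_int a0 \<theta> \<open>0 \<le> C * R\<close> in auto)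
  have "AE p in S.Q \<Otimes>\<^sub>M \<mu>. (\<lambda>n. (\<Sum>j<n. X j p) / (\<Sum>j<n. a j)) \<longlonglongrightarrow> 1"
    by (rule S.Q\<mu>.AE_partial_sums_over_means_tendsto_1[where c="2 * (C * R) / (1 - \<theta>)"])
      (use X0 a0 var assms(6) E in auto)
  moreover have "AE (w, x) in S.Q \<Otimes>\<^sub>M \<mu>. \<forall>j. \<phi> j (random_orbit T w j x) = \<psi> j (random_orbit T w j x)"
    using S.AE_random_orbit[OF AE_mu[OF eq]] by (simp add: split_beta' AE_all_countable)
  ultimately show ?thesis
    by eventually_elim (auto simp: X_def E)
qed

end
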